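(* Let $n\geq 3$ and $m\geq 4$ be integers. Then: (i) if $n\geq 4$ is even, $$cr(K_m\times C_n)\leq \frac{n\, m(m-1)(m-2)(3m-5)}{12};$$ (ii) if $n$ is odd and $4\leq m\leq n$, $$cr(K_m\times C_n)\leq \frac{n\, m(m-1)(m-2)(3m-5)}{12}+\frac{m(m-1)}{2};$$ (iii) if $n=3$ and $m>3$, $$cr(K_m\times C_n)\leq \frac{n\, m(m-1)(m-2)(3m-5)}{12}+\frac{28m^{3}-54m^{2}+42m+16}{108};$$ (iv) if $n\geq 5$ is odd and $m>n$, $$cr(K_m\times C_n)\leq \frac{n\, m(m-1)(m-2)(3m-5)}{12}+\frac{m^{3}}{4}.$$
   Context: The crossing number $cr(G)$ of a graph $G$ is the smallest number of pairwise crossings of edges among all drawings of $G$ in the plane. $K_m$ is the complete graph on $m$ vertices and $C_n$ is the cycle on $n$ vertices. $\times$ denotes the Kronecker (direct) product: $V(G\times H)=V(G)\times V(H)$ and $E(G\times H)=\{\{(a,x),(b,y)\}:\{a,b\}\in E(G)\text{ and }\{x,y\}\in E(H)\}$. Thus $K_m\times C_n$ has vertices $(i,j)$ with $0\le i\le m-1$, $0\le j\le n-1$, and edges $\{(i_1,j),(i_2,j+1)\}$ for $0\le i_1\ne i_2\le m-1$, $0\le j\le n-1$, the second coordinate being taken modulo $n$. *)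

theory Defs
  imports "HOL-Analysis.Analysis"
begin

text \<open>Finite simple graphs: a vertex set together with a set of two-element sets of vertices.\<close>

type_synonym 'a ugraph = "'a set \<times> 'a set set"

abbreviation verts :: "'a ugraph \<Rightarrow> 'a set" where
  "verts G \<equiv> fst G"

abbreviation edges :: "'a ugraph \<Rightarrow> 'a set set" where
  "edges G \<equiv> snd G"

definition complete_graph :: "nat \<Rightarrow> nat ugraph" where
  "complete_graph m = ({0..<m}, {{a, b} | a b. a < m \<and> b < m \<and> a \<noteq> b})"

text \<open>This is the cycle of length \<open>n\<close> only for \<open>n \<ge> 3\<close>.\<close>

definition cycle_graph :: "nat \<Rightarrow> nat ugraph" where
  "cycle_graph n = ({0..<n}, {{j, (j + 1) mod n} | j. j < n})"

definition kronecker_product :: "'a ugraph \<Rightarrow> 'b ugraph \<Rightarrow> ('a \<times> 'b) ugraph" where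
  "kronecker_product G H =
     (verts G \<times> verts H,
      {{(a, x), (b, y)} | a b x y. {a, b} \<in> edges G \<and> {x, y} \<in> edges H})"

text \<open>
  Two plane sets cross at \<open>x\<close> (as opposed to merely touching there) if some homeomorphism from
  an open neighbourhood of \<open>x\<close> onto the unit disc straightens them to the two coordinate axes.
\<close>

definition cross_at :: "complex set \<Rightarrow> complex set \<Rightarrow> complex \<Rightarrow> bool" where
  "cross_at A B x \<longleftrightarrow>
     (\<exists>U h k. open U \<and> x \<in> U \<and> homeomorphism U (ball 0 1) h k \<and> h x = 0 \<and>
        h ` (A \<inter> U) = {z \<in> ball 0 1. Im z = 0} \<and>
        h ` (B \<inter> U) = {z \<in> ball 0 1. Re z = 0})"

definition edge_interior :: "('a set \<Rightarrow> real \<Rightarrow> complex) \<Rightarrow> 'a set \<Rightarrow> complex set" where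
  "edge_interior \<gamma> e = \<gamma> e ` {0<..<1}"

text \<open>
  A drawing in the plane: vertices become distinct points, every edge becomes a simple arc
  joining its end vertices and avoiding all other vertices, and the interiors of two distinct
  edges have only finitely many common points, each of them a proper crossing.
  Three or more edges may pass through the same point; see the next definition.
\<close>

definition is_drawing ::
    "'a ugraph \<Rightarrow> ('a \<Rightarrow> complex) \<Rightarrow> ('a set \<Rightarrow> real \<Rightarrow> complex) \<Rightarrow> bool" where
  "is_drawing G p \<gamma> \<longleftrightarrow>
     inj_on p (verts G) \<and>
     (\<forall>e\<in>edges G. arc (\<gamma> e) \<and>
        {pathstart (\<gamma> e), pathfinish (\<gamma> e)} = p ` e \<and>
        edge_interior \<gamma> e \<inter> p ` verts G = {}) \<and>
     (\<forall>e\<in>edges G. \<forall>f\<in>edges G. e \<noteq> f \<longrightarrow>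
        finite (edge_interior \<gamma> e \<inter> edge_interior \<gamma> f) \<and>
        (\<forall>x\<in>edge_interior \<gamma> e \<inter> edge_interior \<gamma> f.
           cross_at (edge_interior \<gamma> e) (edge_interior \<gamma> f) x))"

text \<open>
  Crossings are counted pairwise: a crossing is an unordered pair of distinct edges together
  with a point where they cross, so a point common to the interiors of \<open>k\<close> edges counts
  \<open>k choose 2\<close> times, and two edges crossing repeatedly are counted at each crossing point.
\<close>

definition crossings :: "'a ugraph \<Rightarrow> ('a set \<Rightarrow> real \<Rightarrow> complex) \<Rightarrow> ('a set set \<times> complex) set" where
  "crossings G \<gamma> =
     {({e, f}, x) | e f x. e \<in> edges G \<and> f \<in> edges G \<and> e \<noteq> f \<and>
        x \<in> edge_interior \<gamma> e \<inter> edge_interior \<gamma> f}"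

text \<open>Meaningful for finite simple graphs: these have a drawing, and \<open>crossings\<close> is then finite.\<close>

definition crossing_number :: "'a ugraph \<Rightarrow> nat" where
  "crossing_number G = (LEAST k. \<exists>p \<gamma>. is_drawing G p \<gamma> \<and> card (crossings G \<gamma>) = k)"

end

theory Submission
  imports Defs
begin

text \<open>
  Put the \<open>j\<close>-th copy of the vertices of \<open>K\<^sub>m\<close> on the ray of angle \<open>2 \<pi> j / n\<close>, in the order given by a
  permutation \<open>q\<^sub>j\<close>, and draw all edges as straight segments. Two edges cross iff they lie in the same
  sector and their ends are in opposite order on the two bounding rays. Counting these pairs by
  inclusion--exclusion, the sector between \<open>q = q\<^sub>j\<close> and \<open>r = q\<^sub>j\<^sub>+\<^sub>1\<close> contributes
  \<open>m (m - 1) (m - 2) (3 m - 5) / 12 + (\<Sum>i. (q i + r i - (m - 1))\<^sup>2)\<close> crossings minus the number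
  of pairs of vertices that \<open>q\<close> and \<open>r\<close> order alike. Reversing the order at each step is thus free,
  which settles even \<open>n\<close>.

  For odd \<open>n\<close> a further reversal has to be distributed over the steps. Let \<open>\<int> / 2 m\<close> be folded
  onto the \<open>m\<close> positions by identifying \<open>y\<close> with \<open>2 m - 1 - y\<close>. The residues of a fixed parity occupy each
  position once, and a shift by \<open>m\<close> reverses the order; so shift by \<open>m + s\<^sub>j\<close> in step \<open>j\<close>, where the
  \<open>s\<^sub>j\<close> add up to \<open>m\<close>. Averaging over the two parities turns the sum of squares for a step into a
  cubic polynomial in \<open>s\<^sub>j\<close>, and since \<open>n\<close> is odd each pair of vertices is ordered alike at least once,
  which saves \<open>m (m - 1) / 2\<close>. It remains to take \<open>m\<close> shifts by \<open>1\<close>, or three (five) shifts by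
  about \<open>m / 3\<close> (\<open>m / 5\<close>).
\<close>

section \<open>Crossing segments and sectors\<close>

text \<open>The affine map carrying the coordinate axes to the lines through \<open>x\<close> in
  directions \<open>d\<close> and \<open>e\<close> is a homeomorphism of the plane. Scaling by
  \<open>r\<close> ensures that, along each axis, the unit disc only sees parameters lying in
  \<open>I\<close> and \<open>J\<close>.\<close>

lemma cross_at_lines:
  fixes x d e :: complex
  assumes indep: "Im (cnj d * e) \<noteq> 0"
    and I: "open I" "0 \<in> I" and J: "open J" "0 \<in> J"
  shows "cross_at ((\<lambda>s. x + of_real s * d) ` I) ((\<lambda>s. x + of_real s * e) ` J) x"
proof -
  obtain r where r: "r > 0" "ball 0 r \<subseteq> I \<inter> J"
    using openE[OF open_Int[OF I(1) J(1)], of 0] I J by blast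
  define D where "D = Im (cnj d * e)"
  have D: "D = Re d * Im e - Im d * Re e" "D \<noteq> 0"
    using indep by (auto simp: D_def)
  define k where "k w = x + of_real r * (of_real (Re w) * d + of_real (Im w) * e)" for w
  \<comment> \<open>Cramer's rule for the coordinates with respect to \<open>d\<close> and
    \<open>e\<close>, with determinant \<open>D\<close>; thus \<open>h\<close> inverts
    \<open>k\<close>.\<close>
  define h where "h z = Complex (Im (cnj (z - x) * e) / (r * D)) (Im (cnj d * (z - x)) / (r * D))" for z
  have hk: "h (k w) = w" for w
    using r D by (simp add: h_def k_def complex_eq_iff field_simps) (simp add: D(1) algebra_simps)
  have kh: "k (h z) = z" for z
    using r D(2) by (simp add: h_def k_def complex_eq_iff field_simps) (simp add: D(1) algebra_simps)
  have inj: "h z = h w \<longleftrightarrow> z = w" for z w using kh by metis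
  have conth: "continuous_on UNIV h"
    unfolding h_def Complex_eq by (intro continuous_intros) (use r D in auto)
  have contk: "continuous_on UNIV k"
    unfolding k_def by (intro continuous_intros)
  define U where "U = h -` ball 0 1"
  have "open U" unfolding U_def using conth open_vimage by blast
  moreover have hx: "h x = 0" by (simp add: h_def complex_eq_iff)
  moreover have "x \<in> U" by (simp add: U_def hx)
  moreover have "homeomorphism U (ball 0 1) h k"
  proof (rule homeomorphismI)
    show "k ` ball 0 1 \<subseteq> U" "h ` U \<subseteq> ball 0 1" by (auto simp: U_def hk)
  qed (use conth contk continuous_on_subset in \<open>auto simp: hk kh\<close>)
  moreover have "h ` ((\<lambda>s. x + of_real s * d) ` I \<inter> U) = {z \<in> ball 0 1. Im z = 0}"
  proof -
    have 1: "h (x + of_real s * d) = of_real (s / r)" for s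
      using hk[of "of_real (s/r)"] r by (simp add: k_def)
    show ?thesis
    proof safe
      fix z :: complex assume z: "z \<in> ball 0 1" "Im z = 0"
      then have z': "z = of_real (Re z)" by (simp add: complex_eq_iff)
      define s where "s = r * Re z"
      have "\<bar>Re z\<bar> < 1" using z z' by (metis mem_ball_0 norm_of_real)
      then have "s \<in> I" using r by (intro subsetD[OF r(2), THEN IntD1]) (simp add: s_def abs_mult)
      moreover have "h (x + of_real s * d) = z" using 1[of s] z' r by (simp add: s_def)
      ultimately show "z \<in> h ` ((\<lambda>s. x + of_real s * d) ` I \<inter> U)"
        using z(1) by (auto simp: U_def)
    qed (auto simp: U_def 1)
  qed
  moreover have "h ` ((\<lambda>s. x + of_real s * e) ` J \<inter> U) = {z \<in> ball 0 1. Re z = 0}"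
  proof -
    have 1: "h (x + of_real s * e) = \<i> * of_real (s / r)" for s
      using hk[of "\<i> * of_real (s/r)"] r by (simp add: k_def)
    show ?thesis
    proof safe
      fix z :: complex assume z: "z \<in> ball 0 1" "Re z = 0"
      then have z': "z = \<i> * of_real (Im z)" by (simp add: complex_eq_iff)
      define s where "s = r * Im z"
      have "\<bar>Im z\<bar> < 1" using z abs_Im_le_cmod[of z] by simp
      then have "s \<in> J" using r by (intro subsetD[OF r(2), THEN IntD2]) (simp add: s_def abs_mult)
      moreover have "h (x + of_real s * e) = z" using 1[of s] z' r by (simp add: s_def)
      ultimately show "z \<in> h ` ((\<lambda>s. x + of_real s * e) ` J \<inter> U)"
        using z(1) by (auto simp: U_def)
    qed (auto simp: U_def 1)
  qed
  ultimately show ?thesis unfolding cross_at_def by blast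
qed

text \<open>Shifting both parameters so that the common point has parameter 0 reduces this to
  \<open>cross_at_lines\<close>.\<close>

lemma cross_at_open_segments:
  fixes a b c d :: complex
  assumes "t \<in> {0<..<1}" "s \<in> {0<..<1}" and eq: "linepath a b t = linepath c d s"
    and indep: "Im (cnj (b - a) * (d - c)) \<noteq> 0"
  shows "cross_at (linepath a b ` {0<..<1}) (linepath c d ` {0<..<1}) (linepath a b t)"
proof -
  have *: "linepath a b ` {0<..<1} = (\<lambda>s. linepath a b t + of_real s * (b - a)) ` {-t<..<1-t}"
    for a b :: complex and t :: real
  proof -
    have "linepath a b (t + s) = linepath a b t + of_real s * (b - a)" for s
      by (simp add: linepath_def scaleR_conv_of_real algebra_simps)
    moreover have "{0<..<1} = (\<lambda>s. t + s) ` {-t<..<1-t}"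
      by (auto simp: image_iff intro!: bexI[of _ "_ - t"])
    ultimately show ?thesis
      by (metis (no_types, lifting) image_cong image_image)
  qed
  show ?thesis
    unfolding *[of a b t] *[of c d s] eq[symmetric]
    by (rule cross_at_lines[OF indep]) (use assms in auto)
qed

text \<open>Keeps the interior of an edge strictly between its two rays. Rotating by
  \<open>-\<theta>\<close> reduces the claim to the argument \<open>\<delta>\<close> of
  \<open>w\<close>.\<close>

lemma Arg2pi_cone:
  fixes a b \<beta> \<theta> :: real
  assumes "0 < a" "0 < b" "0 < \<beta>" "\<beta> < pi" "0 \<le> \<theta>" "\<theta> + \<beta> \<le> 2 * pi"
  defines "z \<equiv> of_real a * cis \<theta> + of_real b * cis (\<theta> + \<beta>)"
  shows "\<theta> < Arg2pi z" "Arg2pi z < \<theta> + \<beta>"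
proof -
  define w where "w = of_real a + of_real b * cis \<beta>"
  have sin: "sin \<beta> > 0" using assms by (simp add: sin_gt_zero)
  have Imw: "Im w > 0" using sin assms by (simp add: w_def)
  then have w0: "w \<noteq> 0" by auto
  define \<delta> where "\<delta> = Arg2pi w"
  have \<delta>: "0 < \<delta>" "\<delta> < pi" using Imw Arg2pi_lt_pi[of w] by (auto simp: \<delta>_def)
  have wd: "w = of_real (cmod w) * cis \<delta>"
    using Arg2pi_eq[of w] by (simp add: \<delta>_def cis_conv_exp)
  have "\<delta> < \<beta>"
  proof (rule ccontr)
    assume "\<not> \<delta> < \<beta>"
    \<comment> \<open>Turning \<open>w\<close> back by \<open>\<beta>\<close> leaves the imaginary
      part \<open>- a * sin \<beta>\<close>, which is negative, so \<open>\<delta>\<close> cannot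
      reach \<open>\<beta>\<close>.\<close>
    then have "sin (\<delta> - \<beta>) \<ge> 0" using \<delta> assms by (intro sin_ge_zero) auto
    then have "Im (w * cis (-\<beta>)) \<ge> 0"
      by (subst wd) (simp add: mult.assoc cis_mult del: cis_inverse)
    moreover have "w * cis (-\<beta>) = of_real a * cis (-\<beta>) + of_real b"
      by (simp add: w_def distrib_right mult.assoc cis_mult)
    ultimately show False using sin assms by (simp add: mult_le_0_iff)
  qed
  have "z = cis \<theta> * w" by (simp add: z_def w_def cis_mult[symmetric] algebra_simps)
  also have "\<dots> = of_real (cmod w) * exp (\<i> * of_real (\<theta> + \<delta>))"
    by (subst wd) (simp add: cis_conv_exp exp_add algebra_simps)
  finally have "Arg2pi z = \<theta> + \<delta>"
    using w0 assms \<open>\<delta> < \<beta>\<close> \<delta> by (intro Arg2pi_unique[of "cmod w"]) auto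
  then show "\<theta> < Arg2pi z" "Arg2pi z < \<theta> + \<beta>" using \<open>\<delta> < \<beta>\<close> \<delta> by auto
qed

lemma cone_coordinates_unique:
  fixes a b a' b' \<beta> \<theta> :: real
  assumes "sin \<beta> \<noteq> 0"
    and eq: "of_real a * cis \<theta> + of_real b * cis (\<theta> + \<beta>) = of_real a' * cis \<theta> + of_real b' * cis (\<theta> + \<beta>)"
  shows "a = a'" "b = b'"
proof -
  have "cis \<theta> * (of_real a + of_real b * cis \<beta>) = cis \<theta> * (of_real a' + of_real b' * cis \<beta>)"
    using eq by (simp add: cis_mult[symmetric] algebra_simps)
  then have "of_real a + of_real b * cis \<beta> = of_real a' + of_real b' * cis \<beta>"
    by simp
  then show "a = a'" "b = b'" using assms(1) by (auto simp: complex_eq_iff)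
qed

lemma less_iff_of_mult_eq:
  fixes s t a b :: real
  assumes "s * a = t * b" "0 < s" "0 < t" "0 < a" "0 < b"
  shows "a < b \<longleftrightarrow> t < s"
proof
  assume "a < b"
  show "t < s"
  proof (rule ccontr)
    assume "\<not> t < s"
    then have "s * a < t * b" using \<open>a < b\<close> assms by (intro mult_le_less_imp_less) auto
    then show False using assms by simp
  qed
next
  assume "t < s"
  show "a < b"
  proof (rule ccontr)
    assume "\<not> a < b"
    then have "t * b < s * a" using \<open>t < s\<close> assms by (intro mult_less_le_imp_less) auto
    then show False using assms by simp
  qed
qed

text \<open>A larger coordinate needs a smaller weight to give the same product, and the weights
  \<open>1 - t\<close> and \<open>t\<close> change in opposite directions. Hence segments between
  the same two rays meet only if they coincide or have their ends in opposite order.\<close>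

lemma weighted_meet:
  fixes a b a' b' t t' :: real
  assumes "a > 0" "b > 0" "a' > 0" "b' > 0" "t \<in> {0<..<1}" "t' \<in> {0<..<1}"
    and "(1 - t) * a = (1 - t') * a'" "t * b = t' * b'"
  shows "a = a' \<and> b = b' \<or> a < a' \<and> b > b' \<or> a > a' \<and> b < b'"
  using less_iff_of_mult_eq[of "1 - t" a "1 - t'" a'] less_iff_of_mult_eq[of "1 - t'" a' "1 - t" a]
    less_iff_of_mult_eq[of t b t' b'] less_iff_of_mult_eq[of t' b' t b] assms
  by auto

section \<open>The straight-line drawing\<close>

text \<open>\<open>i\<close> and \<open>k\<close> lie in one column, with positions \<open>q\<close>, and \<open>i'\<close> and \<open>k'\<close> in the next, with positions \<open>r\<close>.\<close>

definition swapped_edges :: "nat \<Rightarrow> (nat \<Rightarrow> nat) \<Rightarrow> (nat \<Rightarrow> nat) \<Rightarrow> ((nat \<times> nat) \<times> (nat \<times> nat)) set" where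
  "swapped_edges m q r = {((i, i'), (k, k')).
     i < m \<and> i' < m \<and> k < m \<and> k' < m \<and> i \<noteq> i' \<and> k \<noteq> k' \<and> q i < q k \<and> r k' < r i'}"

lemma finite_swapped_edges: "finite (swapped_edges m q r)"
  by (rule finite_subset[of _ "({..<m} \<times> {..<m}) \<times> ({..<m} \<times> {..<m})"])
     (auto simp: swapped_edges_def)

lemma edges_kronecker_complete_cycle:
  "edges (kronecker_product (complete_graph m) (cycle_graph n)) =
     (\<lambda>(j, i, i'). {(i, j), (i', (j + 1) mod n)}) ` {(j, i, i'). j < n \<and> i < m \<and> i' < m \<and> i \<noteq> i'}"
    (is "?L = ?E ` ?T")
proof
  show "?L \<subseteq> ?E ` ?T"
  proof
    fix e assume "e \<in> ?L"
    then obtain a b x y where e: "e = {(a, x), (b, y)}"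
      and abxy: "{a, b} \<in> edges (complete_graph m)" "{x, y} \<in> edges (cycle_graph n)"
      unfolding kronecker_product_def by auto
    from abxy(1) have ab: "a < m" "b < m" "a \<noteq> b"
      by (auto simp: complete_graph_def doubleton_eq_iff)
    from abxy(2) obtain j where j: "j < n" "{x, y} = {j, (j + 1) mod n}"
      unfolding cycle_graph_def by auto
    from j(2) consider "x = j" "y = (j + 1) mod n" | "y = j" "x = (j + 1) mod n"
      by (auto simp: doubleton_eq_iff)
    then show "e \<in> ?E ` ?T"
    proof cases
      case 1
      then show ?thesis using e ab j by (intro image_eqI[of _ _ "(j, a, b)"]) auto
    next
      case 2
      then show ?thesis using e ab j by (intro image_eqI[of _ _ "(j, b, a)"]) auto
    qed
  qed
  show "?E ` ?T \<subseteq> ?L"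
    by (fastforce simp: kronecker_product_def complete_graph_def cycle_graph_def)
qed

text \<open>Because \<open>n \<ge> 3\<close>, each sector has an angle below \<open>pi\<close>, so a
  segment joining its two rays stays inside it. Column \<open>n\<close> is column \<open>0\<close>
  met again after a full turn, whence \<open>closed\<close>.\<close>

theorem crossing_number_le_swapped_edges:
  fixes q :: "nat \<Rightarrow> nat \<Rightarrow> nat"
  assumes n: "n \<ge> 3"
    and inj: "\<And>j. j \<le> n \<Longrightarrow> inj_on (q j) {..<m}"
    and closed: "\<And>i. i < m \<Longrightarrow> q n i = q 0 i"
  shows "crossing_number (kronecker_product (complete_graph m) (cycle_graph n))
    \<le> (\<Sum>j<n. card (swapped_edges m (q j) (q (Suc j))))"
proof -
  define G where "G = kronecker_product (complete_graph m) (cycle_graph n)"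
  define \<beta> where "\<beta> = 2 * pi / n"
  have \<beta>: "0 < \<beta>" "\<beta> < pi" "\<beta> * n = 2 * pi"
    using n by (auto simp: \<beta>_def field_simps)
  have sin\<beta>: "sin \<beta> > 0" using \<beta> by (simp add: sin_gt_zero)
  define \<theta> where "\<theta> j = \<beta> * real j" for j
  have \<theta>Suc: "\<theta> (Suc j) = \<theta> j + \<beta>" for j by (simp add: \<theta>_def algebra_simps)
  have \<theta>mono: "\<theta> j \<le> \<theta> k" if "j \<le> k" for j k
    using that \<beta> by (simp add: \<theta>_def)
  have \<theta>n: "\<theta> n = 2 * pi" and \<theta>0: "\<theta> j \<ge> 0" for j using \<beta> by (auto simp: \<theta>_def)
  \<comment> \<open>The summand 1 keeps every vertex off the origin, where all rays meet.\<close>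
  define P where "P j i = complex_of_real (1 + real (q j i)) * cis (\<theta> j)" for j i
  define p where "p v = P (snd v) (fst v)" for v
  have Pn: "P n i = P 0 i" if "i < m" for i
    using closed[OF that] by (simp add: P_def \<theta>n) (simp add: \<theta>_def)
  have pnext: "p (i, (j + 1) mod n) = P (Suc j) i" if "i < m" "j < n" for i j
    using that n Pn by (cases "Suc j = n") (auto simp: p_def)
  have ArgP: "Arg2pi (P j i) = \<theta> j" if "j < n" for i j
  proof -
    have "\<theta> j < 2 * pi" unfolding \<theta>n[symmetric] using that \<beta>(1) by (simp add: \<theta>_def)
    then show ?thesis
      by (intro Arg2pi_unique[of "1 + real (q j i)"]) (auto simp: P_def cis_conv_exp \<theta>0)
  qed
  have normP: "cmod (P j i) = 1 + real (q j i)" for j i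
    unfolding P_def norm_mult norm_cis norm_of_real by simp
  have Peq: "j = k \<and> i = l" if "P j i = P k l" "j < n" "k < n" "i < m" "l < m" for i j k l
  proof -
    have "\<theta> j = \<theta> k" using ArgP that by metis
    then have "j = k" using \<beta> by (simp add: \<theta>_def)
    moreover have "q j i = q k l" using normP[of j i] normP[of k l] that(1) by simp
    ultimately show ?thesis using inj[of j] that by (auto dest: inj_onD)
  qed
  define T where "T = {(j, i, i'). j < n \<and> i < m \<and> i' < m \<and> i \<noteq> i'}"
  define E where "E = (\<lambda>(j, i :: nat, i'). {(i, j), (i', (j + 1) mod n)})"
  have edges: "edges G = E ` T"
    unfolding G_def E_def T_def by (rule edges_kronecker_complete_cycle)
  have verts: "verts G = {..<m} \<times> {..<n}"
    by (auto simp: G_def kronecker_product_def complete_graph_def cycle_graph_def)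
  \<comment> \<open>Picks an index triple for each edge, which fixes its sector and the direction in
    which its segment is drawn.\<close>
  define t where "t = inv_into T E"
  define \<gamma> where "\<gamma> e = (case t e of (j, i, i') \<Rightarrow> linepath (P j i) (P (Suc j) i'))" for e
  have edgeE: "\<exists>j i i'. t e = (j, i, i') \<and> j < n \<and> i < m \<and> i' < m \<and> i \<noteq> i'
      \<and> e = {(i, j), (i', (j + 1) mod n)} \<and> \<gamma> e = linepath (P j i) (P (Suc j) i')" if "e \<in> edges G" for e
  proof -
    have "t e \<in> T" "E (t e) = e"
      using that unfolding edges t_def by (rule inv_into_into, rule f_inv_into_f)
    then show ?thesis by (cases "t e") (auto simp: T_def E_def \<gamma>_def)
  qed
  have lp: "linepath (P j i) (P (Suc j) i') s =
      of_real ((1 - s) * (1 + real (q j i))) * cis (\<theta> j)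
      + of_real (s * (1 + real (q (Suc j) i'))) * cis (\<theta> j + \<beta>)" for i i' j s
    by (simp add: linepath_def P_def \<theta>Suc scaleR_conv_of_real)
  have sector: "\<theta> j < Arg2pi (linepath (P j i) (P (Suc j) i') s)
      \<and> Arg2pi (linepath (P j i) (P (Suc j) i') s) < \<theta> (Suc j)"
    if "j < n" "s \<in> {0<..<1}" for i i' j s
    unfolding lp \<theta>Suc using that \<beta> \<theta>0[of j] \<theta>mono[of "Suc j" n] \<theta>n \<theta>Suc
    by (intro conjI Arg2pi_cone) auto
  have same_sector: "j = k" if "\<theta> j < x" "x < \<theta> (Suc j)" "\<theta> k < x" "x < \<theta> (Suc k)" for j k x
    using that \<theta>mono[of "Suc j" k] \<theta>mono[of "Suc k" j] by (cases j k rule: linorder_cases) auto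
  have meet: "P j i = P j k \<and> P (Suc j) i' = P (Suc j) k'
      \<or> q j i < q j k \<and> q (Suc j) i' > q (Suc j) k'
      \<or> q j i > q j k \<and> q (Suc j) i' < q (Suc j) k'"
    and meet_coords: "(1 - s) * (1 + real (q j i)) = (1 - u) * (1 + real (q j k))
      \<and> s * (1 + real (q (Suc j) i')) = u * (1 + real (q (Suc j) k'))"
    if "linepath (P j i) (P (Suc j) i') s = linepath (P j k) (P (Suc j) k') u"
      "s \<in> {0<..<1}" "u \<in> {0<..<1}" for i i' j k k' s u
  proof -
    show *: "(1 - s) * (1 + real (q j i)) = (1 - u) * (1 + real (q j k))
      \<and> s * (1 + real (q (Suc j) i')) = u * (1 + real (q (Suc j) k'))"
      using cone_coordinates_unique[OF _ that(1)[unfolded lp]] sin\<beta> by simp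
    show "P j i = P j k \<and> P (Suc j) i' = P (Suc j) k'
      \<or> q j i < q j k \<and> q (Suc j) i' > q (Suc j) k'
      \<or> q j i > q j k \<and> q (Suc j) i' < q (Suc j) k'"
      using weighted_meet[of "1 + real (q j i)" "1 + real (q (Suc j) i')"
          "1 + real (q j k)" "1 + real (q (Suc j) k')" s u] that(2,3) *
      by (auto simp: P_def)
  qed
  \<comment> \<open>The argument of a common point determines the sector; coinciding ends in
    \<open>meet\<close> are excluded because injectivity of the positions would give
    \<open>e = f\<close>.\<close>
  have common: "\<exists>j i i' k k' s u. t e = (j, i, i') \<and> t f = (j, k, k') \<and> j < n
      \<and> i < m \<and> i' < m \<and> i \<noteq> i' \<and> k < m \<and> k' < m \<and> k \<noteq> k'
      \<and> s \<in> {0<..<1} \<and> u \<in> {0<..<1}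
      \<and> z = linepath (P j i) (P (Suc j) i') s \<and> z = linepath (P j k) (P (Suc j) k') u
      \<and> e = {(i, j), (i', (j + 1) mod n)} \<and> f = {(k, j), (k', (j + 1) mod n)}
      \<and> \<gamma> e = linepath (P j i) (P (Suc j) i') \<and> \<gamma> f = linepath (P j k) (P (Suc j) k')
      \<and> (q j i < q j k \<and> q (Suc j) i' > q (Suc j) k' \<or> q j i > q j k \<and> q (Suc j) i' < q (Suc j) k')"
    if ef: "e \<in> edges G" "f \<in> edges G" "e \<noteq> f"
      and z: "z \<in> edge_interior \<gamma> e" "z \<in> edge_interior \<gamma> f" for e f z
  proof -
    obtain j i i' where e: "t e = (j, i, i')" "j < n" "i < m" "i' < m" "i \<noteq> i'"
      "e = {(i, j), (i', (j + 1) mod n)}" "\<gamma> e = linepath (P j i) (P (Suc j) i')"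
      using edgeE[OF ef(1)] by blast
    obtain l k k' where f: "t f = (l, k, k')" "l < n" "k < m" "k' < m" "k \<noteq> k'"
      "f = {(k, l), (k', (l + 1) mod n)}" "\<gamma> f = linepath (P l k) (P (Suc l) k')"
      using edgeE[OF ef(2)] by blast
    obtain s where s: "s \<in> {0<..<1}" "z = linepath (P j i) (P (Suc j) i') s"
      using z(1) e by (auto simp: edge_interior_def)
    obtain u where u: "u \<in> {0<..<1}" "z = linepath (P l k) (P (Suc l) k') u"
      using z(2) f by (auto simp: edge_interior_def)
    have "j = l"
      using sector[OF e(2) s(1), of i i'] sector[OF f(2) u(1), of k k']
      unfolding s(2)[symmetric] u(2)[symmetric] by (auto intro: same_sector)
    have "\<not> (P j i = P j k \<and> P (Suc j) i' = P (Suc j) k')"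
    proof
      assume *: "P j i = P j k \<and> P (Suc j) i' = P (Suc j) k'"
      then have "q j i = q j k" "q (Suc j) i' = q (Suc j) k'"
        using normP by (metis add_left_cancel of_nat_eq_iff)+
      then have "i = k" "i' = k'"
        using inj[of j] inj[of "Suc j"] e f by (auto dest: inj_onD)
      then show False using ef(3) e f \<open>j = l\<close> by simp
    qed
    then show ?thesis
      using meet[of j i i' s k k' u] s u e f \<open>j = l\<close> by blast
  qed
  \<comment> \<open>The determinant of the two directions is \<open>sin \<beta>\<close> times the
    difference of the two products in \<open>unequal\<close>. When the ends are in opposite order,
    both factors of one product exceed those of the other.\<close>
  have indep: "Im (cnj (P (Suc j) i' - P j i) * (P (Suc j) k' - P j k)) \<noteq> 0"
    and unequal: "(1 + real (q j k)) * (1 + real (q (Suc j) i')) \<noteq> (1 + real (q j i)) * (1 + real (q (Suc j) k'))"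
    if "q j i < q j k \<and> q (Suc j) i' > q (Suc j) k' \<or> q j i > q j k \<and> q (Suc j) i' < q (Suc j) k'"
    for i i' j k k'
  proof -
    have mm: "a * b' < a' * b" if "0 < a" "a < a'" "0 < b'" "b' < b" for a b a' b' :: real
      using that by (intro mult_strict_mono) auto
    show ne: "(1 + real (q j k)) * (1 + real (q (Suc j) i')) \<noteq> (1 + real (q j i)) * (1 + real (q (Suc j) k'))"
      using that mm[of "1 + real (q j i)" "1 + real (q j k)" "1 + real (q (Suc j) k')" "1 + real (q (Suc j) i')"]
        mm[of "1 + real (q j k)" "1 + real (q j i)" "1 + real (q (Suc j) i')" "1 + real (q (Suc j) k')"]
      by auto
    have "Im (cnj (of_real b * cis (\<theta> j + \<beta>) - of_real a * cis (\<theta> j))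
        * (of_real b' * cis (\<theta> j + \<beta>) - of_real a' * cis (\<theta> j))) = (a' * b - a * b') * sin \<beta>"
      for a b a' b' :: real
    proof -
      have eq: "sin \<beta> = sin (\<theta> j + \<beta>) * cos (\<theta> j) - cos (\<theta> j + \<beta>) * sin (\<theta> j)"
        using sin_diff[of "\<theta> j + \<beta>" "\<theta> j"] by simp
      show ?thesis unfolding eq by (simp add: algebra_simps)
    qed
    then show "Im (cnj (P (Suc j) i' - P j i) * (P (Suc j) k' - P j k)) \<noteq> 0"
      unfolding P_def \<theta>Suc using ne sin\<beta> by simp
  qed
  have unique: "z = w" if ef: "e \<in> edges G" "f \<in> edges G" "e \<noteq> f"
      and z: "z \<in> edge_interior \<gamma> e \<inter> edge_interior \<gamma> f"
      and w: "w \<in> edge_interior \<gamma> e \<inter> edge_interior \<gamma> f" for e f z w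
  proof -
    obtain j i i' k k' s u where 1: "t e = (j, i, i')" "t f = (j, k, k')"
      "s \<in> {0<..<1}" "u \<in> {0<..<1}"
      "z = linepath (P j i) (P (Suc j) i') s" "z = linepath (P j k) (P (Suc j) k') u"
      "q j i < q j k \<and> q (Suc j) i' > q (Suc j) k' \<or> q j i > q j k \<and> q (Suc j) i' < q (Suc j) k'"
      using common[OF ef, of z] z by blast
    obtain s' u' where 2: "s' \<in> {0<..<1}" "u' \<in> {0<..<1}"
      "w = linepath (P j i) (P (Suc j) i') s'" "w = linepath (P j k) (P (Suc j) k') u'"
      using common[OF ef, of w] w 1(1,2) by auto
    define a b a' b' where ab: "a = 1 + real (q j i)" "b = 1 + real (q (Suc j) i')"
      "a' = 1 + real (q j k)" "b' = 1 + real (q (Suc j) k')"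
    have c: "(1 - s) * a = (1 - u) * a'" "s * b = u * b'"
      "(1 - s') * a = (1 - u') * a'" "s' * b = u' * b'"
      using meet_coords[of j i i' s k k' u] meet_coords[of j i i' s' k k' u'] 1 2
      unfolding ab by auto
    \<comment> \<open>Subtracting the equations gives \<open>(s - s') * a = (u - u') * a'\<close>
      and \<open>(s - s') * b = (u - u') * b'\<close>; eliminate \<open>u - u'\<close>.\<close>
    have "(s - s') * (a * b' - a' * b) = 0"
      using c by algebra
    then have "s = s'" using unequal[OF 1(7)] unfolding ab by auto
    then show ?thesis using 1 2 by simp
  qed
  have fin: "finite (edge_interior \<gamma> e \<inter> edge_interior \<gamma> f)"
    if "e \<in> edges G" "f \<in> edges G" "e \<noteq> f" for e f
    using unique[OF that] by (metis finite.simps finite_subset insertI1 singletonD subsetI)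
  have crosses: "cross_at (edge_interior \<gamma> e) (edge_interior \<gamma> f) z"
    if ef: "e \<in> edges G" "f \<in> edges G" "e \<noteq> f"
      and z: "z \<in> edge_interior \<gamma> e \<inter> edge_interior \<gamma> f" for e f z
  proof -
    obtain j i i' k k' s u where
      "s \<in> {0<..<1}" "u \<in> {0<..<1}"
      "z = linepath (P j i) (P (Suc j) i') s" "z = linepath (P j k) (P (Suc j) k') u"
      "\<gamma> e = linepath (P j i) (P (Suc j) i')" "\<gamma> f = linepath (P j k) (P (Suc j) k')"
      "q j i < q j k \<and> q (Suc j) i' > q (Suc j) k' \<or> q j i > q j k \<and> q (Suc j) i' < q (Suc j) k'"
      using common[OF ef, of z] z by blast
    then show ?thesis
      unfolding edge_interior_def using indep
      by (metis cross_at_open_segments)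
  qed
  have draw: "is_drawing G p \<gamma>"
    unfolding is_drawing_def
  proof (intro conjI ballI impI)
    show "inj_on p (verts G)"
      using Peq by (auto simp: inj_on_def p_def verts)
  next
    fix e assume "e \<in> edges G"
    then obtain j i i' where e: "j < n" "i < m" "i' < m" "i \<noteq> i'"
      "e = {(i, j), (i', (j + 1) mod n)}" "\<gamma> e = linepath (P j i) (P (Suc j) i')"
      using edgeE by blast
    have "P j i \<noteq> P (Suc j) i'"
      using Peq[of j i "(j + 1) mod n" i'] e pnext[of i' j] n by (auto simp: p_def)
    then show "arc (\<gamma> e)" using e by (simp add: arc_linepath)
    show "{pathstart (\<gamma> e), pathfinish (\<gamma> e)} = p ` e"
      using e pnext[of i' j] by (simp add: p_def)
    show "edge_interior \<gamma> e \<inter> p ` verts G = {}"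
    proof (rule ccontr)
      assume "edge_interior \<gamma> e \<inter> p ` verts G \<noteq> {}"
      then obtain z where "z \<in> edge_interior \<gamma> e" "z \<in> p ` verts G" by blast
      then obtain s l k where "s \<in> {0<..<1}" "l < n" "linepath (P j i) (P (Suc j) i') s = P l k"
        unfolding edge_interior_def verts e(6) p_def by auto
      then have "\<theta> j < \<theta> l" "\<theta> l < \<theta> (Suc j)"
        using sector[of j s i i'] ArgP[of l k] e by auto
      \<comment> \<open>A vertex has the angle of its ray, and no ray lies strictly between two
        consecutive ones.\<close>
      then show False using \<theta>mono[of l j] \<theta>mono[of "Suc j" l] by (cases "l \<le> j") auto
    qed
  qed (use fin crosses in auto)
  define C where "C = (\<lambda>(j, (i :: nat, i'), (k, k')). {{(i, j), (i', (j + 1) mod n)}, {(k, j), (k', (j + 1) mod n)}})"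
  define S where "S = (SIGMA j:{..<n}. swapped_edges m (q j) (q (Suc j)))"
  \<comment> \<open>As two edges meet at most once, counting crossings amounts to counting pairs of
    edges.\<close>
  have "inj_on fst (crossings G \<gamma>)"
  proof (rule inj_onI)
    fix c c' assume *: "c \<in> crossings G \<gamma>" "c' \<in> crossings G \<gamma>" "fst c = fst c'"
    then obtain e f z e' f' w where c: "c = ({e, f}, z)" "e \<in> edges G" "f \<in> edges G" "e \<noteq> f"
      "z \<in> edge_interior \<gamma> e \<inter> edge_interior \<gamma> f"
      and c': "c' = ({e', f'}, w)" "w \<in> edge_interior \<gamma> e' \<inter> edge_interior \<gamma> f'"
      unfolding crossings_def by blast
    then have "w \<in> edge_interior \<gamma> e \<inter> edge_interior \<gamma> f"
      using *(3) by (auto simp: doubleton_eq_iff)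
    then show "c = c'" using unique[OF c(2-5), of w] c c' *(3) by simp
  qed
  then have "card (crossings G \<gamma>) = card (fst ` crossings G \<gamma>)" by (simp add: card_image)
  also have "fst ` crossings G \<gamma> \<subseteq> C ` S"
  proof
    fix c assume "c \<in> fst ` crossings G \<gamma>"
    then obtain x where x: "c = fst x" "x \<in> crossings G \<gamma>" by blast
    then obtain e f z where "x = ({e, f}, z)" "e \<in> edges G" "f \<in> edges G" "e \<noteq> f"
      "z \<in> edge_interior \<gamma> e" "z \<in> edge_interior \<gamma> f"
      unfolding crossings_def by blast
    with x have c: "c = {e, f}" "e \<in> edges G" "f \<in> edges G" "e \<noteq> f"
      "z \<in> edge_interior \<gamma> e" "z \<in> edge_interior \<gamma> f"
      by simp_all
    obtain j i i' k k' where d: "j < n" "i < m" "i' < m" "i \<noteq> i'" "k < m" "k' < m" "k \<noteq> k'"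
      "e = {(i, j), (i', (j + 1) mod n)}" "f = {(k, j), (k', (j + 1) mod n)}"
      "q j i < q j k \<and> q (Suc j) i' > q (Suc j) k' \<or> q j i > q j k \<and> q (Suc j) i' < q (Suc j) k'"
      using common[OF c(2-6)] by blast
    \<comment> \<open>\<open>swapped_edges\<close> lists first the edge whose end in column
      \<open>j\<close> is lower; the two cases arrange this.\<close>
    from d(10) show "c \<in> C ` S"
    proof
      assume "q j i < q j k \<and> q (Suc j) i' > q (Suc j) k'"
      then show ?thesis using c(1) d(1-9)
        by (intro image_eqI[of _ _ "(j, (i, i'), (k, k'))"]) (auto simp: S_def C_def swapped_edges_def)
    next
      assume "q j i > q j k \<and> q (Suc j) i' < q (Suc j) k'"
      then show ?thesis using c(1) d(1-9)
        by (intro image_eqI[of _ _ "(j, (k, k'), (i, i'))"]) (auto simp: S_def C_def swapped_edges_def)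
    qed
  qed
  then have "card (fst ` crossings G \<gamma>) \<le> card (C ` S)"
    by (intro card_mono) (auto simp: S_def finite_swapped_edges)
  also have "card (C ` S) \<le> card S"
    by (intro card_image_le) (auto simp: S_def finite_swapped_edges)
  also have "card S = (\<Sum>j<n. card (swapped_edges m (q j) (q (Suc j))))"
    by (simp add: S_def finite_swapped_edges)
  finally have "card (crossings G \<gamma>) \<le> (\<Sum>j<n. card (swapped_edges m (q j) (q (Suc j))))" .
  moreover have "crossing_number G \<le> card (crossings G \<gamma>)"
    unfolding crossing_number_def by (rule Least_le) (use draw in blast)
  ultimately show ?thesis unfolding G_def by linarith
qed

section \<open>Counting crossings between two columns\<close>

lemma bij_betw_lessThan:
  fixes q :: "nat \<Rightarrow> nat"
  assumes "inj_on q {..<m}" "\<And>i. i < m \<Longrightarrow> q i < m"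
  shows "bij_betw q {..<m} {..<m}"
  using assms endo_inj_surj[of "{..<m}" q] by (auto simp: bij_betw_def)

lemma card_below:
  assumes "bij_betw q {..<m} {..<m}" "i < m"
  shows "card {k. k < m \<and> q k < q i} = q i"
proof -
  have im: "q ` {..<m} = {..<m}" and inj: "inj_on q {..<m}"
    using assms by (auto simp: bij_betw_def)
  then have "q i < m" using assms(2) by blast
  have "q ` {k. k < m \<and> q k < q i} = {..<q i}"
  proof safe
    fix v assume "v < q i"
    then have "v \<in> q ` {..<m}" using im \<open>q i < m\<close> by auto
    then show "v \<in> q ` {k. k < m \<and> q k < q i}" using \<open>v < q i\<close> by auto
  qed
  then show ?thesis
    using card_image[of q "{k. k < m \<and> q k < q i}"] inj by (auto simp: inj_on_def)
qed

lemma card_above: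
  assumes "bij_betw q {..<m} {..<m}" "i < m"
  shows "card {k. k < m \<and> q i < q k} = m - 1 - q i"
proof -
  have im: "q ` {..<m} = {..<m}" and inj: "inj_on q {..<m}"
    using assms by (auto simp: bij_betw_def)
  have "q ` {k. k < m \<and> q i < q k} = {q i<..<m}"
  proof (intro equalityI subsetI)
    fix v assume v: "v \<in> {q i<..<m}"
    then have "v \<in> q ` {..<m}" using im by auto
    then show "v \<in> q ` {k. k < m \<and> q i < q k}" using v by auto
  qed (use im in auto)
  then show ?thesis
    using card_image[of q "{k. k < m \<and> q i < q k}"] inj by (auto simp: inj_on_def)
qed

lemma sum_lessThan_real: "(\<Sum>i<m. real i) = real m * (real m - 1) / 2"
  by (induction m) (auto simp: field_simps)

lemma sum_lessThan_real_square: "(\<Sum>i<m. (real i)\<^sup>2) = real m * (real m - 1) * (2 * real m - 1) / 6"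
  by (induction m) (auto simp: field_simps power2_eq_square)

lemma sum_bij_lessThan:
  fixes g :: "nat \<Rightarrow> real"
  assumes "bij_betw q {..<m} {..<m}"
  shows "(\<Sum>i<m. g (q i)) = (\<Sum>i<m. g i)"
  using sum.reindex_bij_betw[OF assms] .

lemma card_ordered_pairs:
  assumes q: "bij_betw q {..<m} {..<m}"
  shows "real (card {(i, k). i < m \<and> k < m \<and> q i < q k}) = real m * (real m - 1) / 2"
proof -
  have "{(i, k). i < m \<and> k < m \<and> q i < q k} = prod.swap ` (SIGMA k:{..<m}. {i. i < m \<and> q i < q k})"
    by (auto simp: image_iff)
  then have "card {(i, k). i < m \<and> k < m \<and> q i < q k} = card (SIGMA k:{..<m}. {i. i < m \<and> q i < q k})"
    by (simp only: card_image[OF inj_swap])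
  also have "\<dots> = (\<Sum>k<m. q k)"
    by (simp add: card_below[OF q])
  finally show ?thesis
    using sum_bij_lessThan[OF q, of real] sum_lessThan_real[of m] by simp
qed

definition concordant :: "nat \<Rightarrow> (nat \<Rightarrow> nat) \<Rightarrow> (nat \<Rightarrow> nat) \<Rightarrow> (nat \<times> nat) set" where
  "concordant m q r = {(i, k). i < m \<and> k < m \<and> q i < q k \<and> r i < r k}"

lemma finite_concordant: "finite (concordant m q r)"
  by (rule finite_subset[of _ "{..<m} \<times> {..<m}"]) (auto simp: concordant_def)

text \<open>Inclusion-exclusion over the conditions \<open>i \<noteq> i'\<close> and
  \<open>k \<noteq> k'\<close>. Violating both leaves the pairs that \<open>q\<close> and
  \<open>r\<close> order oppositely, which are all pairs except the concordant ones.\<close>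

lemma card_swapped_edges:
  assumes q: "bij_betw q {..<m} {..<m}" and r: "bij_betw r {..<m} {..<m}"
  shows "real (card (swapped_edges m q r)) =
    real m * (real m - 1) * (real m - 2) * (3 * real m - 5) / 12
    + (\<Sum>i<m. (real (q i) + real (r i) - (real m - 1))\<^sup>2) - real (card (concordant m q r))"
proof -
  define C where "C = real m * (real m - 1) / 2"
  define A where "A = {(i, k). i < m \<and> k < m \<and> q i < q k}"
  define B where "B = {(i', k'). i' < m \<and> k' < m \<and> r k' < r i'}"
  have fA: "finite A" and fB: "finite B"
    by (rule finite_subset[of _ "{..<m} \<times> {..<m}"]; auto simp: A_def B_def)+
  have cA: "real (card A) = C" unfolding A_def C_def by (rule card_ordered_pairs[OF q])
  have "B = prod.swap ` {(i, k). i < m \<and> k < m \<and> r i < r k}" by (auto simp: B_def image_iff)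
  then have cB: "real (card B) = C"
    by (simp only: card_image[OF inj_swap] card_ordered_pairs[OF r] C_def)
  \<comment> \<open>\<open>W\<close> ignores both conditions; in \<open>X\<close> the first edge has
    \<open>i = i'\<close>, in \<open>Y\<close> the second has \<open>k = k'\<close>.\<close>
  define W where "W = (\<lambda>((i, k), (i', k')). ((i, i'), (k, k'))) ` (A \<times> B)"
  define X where "X = (\<lambda>(i, k, k'). ((i, i), (k, k'))) ` (SIGMA i:{..<m}. {k. k < m \<and> q i < q k} \<times> {k. k < m \<and> r k < r i})"
  define Y where "Y = (\<lambda>(k, i, i'). ((i, i'), (k, k))) ` (SIGMA k:{..<m}. {i. i < m \<and> q i < q k} \<times> {i. i < m \<and> r k < r i})"
  define I where "I = {(i, k). i < m \<and> k < m \<and> q i < q k \<and> r k < r i}"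
  have fin: "finite W" "finite X" "finite Y"
    using fA fB by (auto simp: W_def X_def Y_def)
  have cW: "real (card W) = C * C"
    unfolding W_def by (subst card_image) (auto simp: inj_on_def card_cartesian_product cA cB)
  have sub: "real (m - 1 - q i) = real m - 1 - real (q i)"
    "real (m - 1 - r i) = real m - 1 - real (r i)" if "i < m" for i
  proof -
    have "q i < m" "r i < m" using that q r by (auto simp: bij_betw_def)
    then show "real (m - 1 - q i) = real m - 1 - real (q i)"
      "real (m - 1 - r i) = real m - 1 - real (r i)" by auto
  qed
  have "card X = (\<Sum>i<m. (m - 1 - q i) * r i)"
    unfolding X_def by (subst card_image)
      (auto simp: inj_on_def card_cartesian_product card_above[OF q] card_below[OF r])
  then have cX: "real (card X) = (\<Sum>i<m. (real m - 1 - real (q i)) * real (r i))"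
    by (simp only: of_nat_sum of_nat_mult) (rule sum.cong; simp only: sub lessThan_iff)
  have "card Y = (\<Sum>i<m. q i * (m - 1 - r i))"
    unfolding Y_def by (subst card_image)
      (auto simp: inj_on_def card_cartesian_product card_above[OF r] card_below[OF q])
  then have cY: "real (card Y) = (\<Sum>i<m. real (q i) * (real m - 1 - real (r i)))"
    by (simp only: of_nat_sum of_nat_mult) (rule sum.cong; simp only: sub lessThan_iff)
  have "X \<inter> Y = (\<lambda>(i, k). ((i, i), (k, k))) ` I"
    by (auto simp: X_def Y_def I_def image_iff)
  then have cXY: "card (X \<inter> Y) = card I"
    by (simp add: card_image inj_on_def split_def prod_eq_iff)
  have "A = concordant m q r \<union> I"
  proof -
    have "r i < r k \<or> r k < r i" if "i < m" "k < m" "q i < q k" for i k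
      using r that by (auto simp: bij_betw_def inj_on_def neq_iff[symmetric])
    then show ?thesis unfolding A_def I_def concordant_def by auto
  qed
  moreover have "concordant m q r \<inter> I = {}" by (auto simp: I_def concordant_def)
  ultimately have cI: "real (card I) = C - real (card (concordant m q r))"
    using cA fA card_Un_disjoint[of "concordant m q r" I] by simp
  have XY: "X \<union> Y \<subseteq> W"
  proof -
    have "X \<subseteq> W" "Y \<subseteq> W"
      by (force simp: X_def Y_def W_def A_def B_def image_iff)+
    then show ?thesis by simp
  qed
  have "swapped_edges m q r = W - (X \<union> Y)"
    by (auto simp: swapped_edges_def W_def X_def Y_def A_def B_def image_iff)
  then have "real (card (swapped_edges m q r)) = real (card W) - real (card (X \<union> Y))"
    using XY fin by (simp add: card_Diff_subset card_mono of_nat_diff)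
  also have "real (card (X \<union> Y)) = real (card X) + real (card Y) - real (card (X \<inter> Y))"
    using card_Un_Int[OF fin(2,3)] by linarith
  finally have main: "real (card (swapped_edges m q r)) =
      C * C - real (card X) - real (card Y) + C - real (card (concordant m q r))"
    using cXY cI cW by simp
  define M where "M = real m - 1"
  \<comment> \<open>Completing the square absorbs the mixed products \<open>q i * r i\<close>. The
    other sums involve \<open>q\<close> or \<open>r\<close> alone and are thus the same for every
    permutation.\<close>
  have "real (card X) + real (card Y) =
      (\<Sum>i<m. (real (q i))\<^sup>2 - M * real (q i)) + (\<Sum>i<m. (real (r i))\<^sup>2 - M * real (r i))
      + real m * M\<^sup>2 - (\<Sum>i<m. (real (q i) + real (r i) - M)\<^sup>2)"
  proof -
    have eq: "real m * M\<^sup>2 = (\<Sum>i<m. M\<^sup>2)" by simp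
    show ?thesis
      unfolding cX cY M_def[symmetric] eq sum.distrib[symmetric] sum_subtractf[symmetric]
      by (rule sum.cong) (simp_all add: power2_eq_square algebra_simps)
  qed
  also have "(\<Sum>i<m. (real (q i))\<^sup>2 - M * real (q i)) = (\<Sum>i<m. (real i)\<^sup>2 - M * real i)"
    by (rule sum_bij_lessThan[OF q])
  also have "(\<Sum>i<m. (real (r i))\<^sup>2 - M * real (r i)) = (\<Sum>i<m. (real i)\<^sup>2 - M * real i)"
    by (rule sum_bij_lessThan[OF r])
  also have "(\<Sum>i<m. (real i)\<^sup>2 - M * real i)
      = real m * (real m - 1) * (2 * real m - 1) / 6 - M * (real m * (real m - 1) / 2)"
    by (simp add: sum_subtractf sum_distrib_left[symmetric] sum_lessThan_real sum_lessThan_real_square)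
  finally show ?thesis
    unfolding main M_def C_def by (simp add: field_simps power2_eq_square)
qed

section \<open>Permutations from the folded cycle\<close>

text \<open>A triangular wave of period \<open>2 * m\<close> that climbs through the positions and
  descends again, taking each extreme position twice in a row.\<close>

definition zigzag :: "nat \<Rightarrow> nat \<Rightarrow> nat" where
  "zigzag m x = (if x mod (2 * m) < m then x mod (2 * m) else 2 * m - 1 - x mod (2 * m))"

lemma zigzag_less: "m > 0 \<Longrightarrow> zigzag m x < m"
  by (auto simp: zigzag_def)

lemma zigzag_periodic: "zigzag m (x + 2 * m) = zigzag m x"
  by (simp add: zigzag_def)

lemma zigzag_add_half:
  assumes "m > 0"
  shows "zigzag m (x + m) = m - 1 - zigzag m x"
proof -
  define y where "y = x mod (2 * m)"
  have y: "y < 2 * m" using assms by (simp add: y_def)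
  have "(x + m) mod (2 * m) = (y + m) mod (2 * m)"
    by (simp add: y_def mod_add_left_eq)
  also have "\<dots> = (if y < m then y + m else y - m)"
    using y by (auto simp: mod_if)
  finally show ?thesis
    using y by (auto simp: zigzag_def y_def[symmetric])
qed

text \<open>All arguments have the same parity, while the two preimages \<open>y\<close> and \<open>2 m - 1 - y\<close>
  of a position have different parities.\<close>

lemma inj_on_zigzag_double: "inj_on (\<lambda>i. zigzag m (2 * i + c)) {..<m}"
proof (rule linorder_inj_onI)
  fix i k :: nat assume ik: "i < k" "i \<in> {..<m}" "k \<in> {..<m}"
  then have m: "m > 0" by simp
  define y z where "y = (2 * i + c) mod (2 * m)" and "z = (2 * k + c) mod (2 * m)"
  have yz: "y < 2 * m" "z < 2 * m" using m by (simp_all add: y_def z_def)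
  have par: "even y \<longleftrightarrow> even c" "even z \<longleftrightarrow> even c"
    by (simp_all add: y_def z_def dvd_mod_iff)
  have "y \<noteq> z"
  proof
    assume "y = z"
    then have "2 * m dvd (2 * k + c) - (2 * i + c)"
      using ik mod_eq_dvd_iff_nat[of "2 * i + c" "2 * k + c" "2 * m"] by (simp add: y_def z_def)
    then show False using ik by (auto dest: dvd_imp_le)
  qed
  moreover have "y + z + 1 \<noteq> 2 * m"
    using par by (metis dvd_triv_left even_add even_plus_one_iff)
  ultimately show "zigzag m (2 * i + c) \<noteq> zigzag m (2 * k + c)"
    using yz by (auto simp: zigzag_def y_def[symmetric] z_def[symmetric])
qed auto

lemma bij_betw_zigzag_double: "bij_betw (\<lambda>i. zigzag m (2 * i + c)) {..<m} {..<m}"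
  by (rule bij_betw_lessThan[OF inj_on_zigzag_double]) (auto intro: zigzag_less)

section \<open>Sums over one period of the fold\<close>

lemma sum_periodic_shift:
  fixes h :: "nat \<Rightarrow> real"
  assumes "\<And>x. h (x + N) = h x"
  shows "(\<Sum>x<N. h (x + c)) = (\<Sum>x<N. h x)"
proof (induction c)
  case (Suc c)
  have "(\<Sum>x<N. h (Suc x + c)) + h c = (\<Sum>x<N. h (x + c)) + h (N + c)"
    using sum.lessThan_Suc_shift[of "\<lambda>x. h (x + c)" N] by simp
  then show ?case using Suc assms[of c] by (simp add: add.commute)
qed simp

lemma sum_centered_squares:
  "(\<Sum>u<s. (2 * real u + 1 - real s)\<^sup>2) = (real s ^ 3 - real s) / 3"
proof -
  \<comment> \<open>The centre is a free \<open>c\<close>, since it must stay fixed while the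
    induction changes \<open>s\<close>.\<close>
  have eq: "(\<Sum>u<s. (2 * real u + 1 - c)\<^sup>2) =
      real s * (4 * (real s)\<^sup>2 - 1) / 3 - 2 * c * (real s)\<^sup>2 + real s * c\<^sup>2" for c :: real
    by (induction s) (auto simp: field_simps power2_eq_square)
  show ?thesis unfolding eq by (simp add: field_simps power2_eq_square power3_eq_cube)
qed

text \<open>Both halves of the period contribute equally. In the first half, \<open>m - s\<close>
  arguments rise by exactly \<open>s\<close>, and the last \<open>s\<close> pass the turning point,
  where the differences are \<open>2 * u + 1 - s\<close>.\<close>

lemma sum_zigzag_step:
  assumes s: "s \<le> m"
  shows "(\<Sum>x<2*m. (real (zigzag m x) - real (zigzag m (x + s)))\<^sup>2) =
    2 * ((real m - real s) * (real s)\<^sup>2 + (real s ^ 3 - real s) / 3)"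
proof (cases "m = 0")
  case False
  then have m: "m > 0" by simp
  define h where "h x = (real (zigzag m x) - real (zigzag m (x + s)))\<^sup>2" for x
  have half: "h (x + m) = h x" for x
  proof -
    have "real (zigzag m (x + m)) = real m - 1 - real (zigzag m x)" for x
      using zigzag_add_half[OF m, of x] zigzag_less[OF m, of x] m by (simp add: of_nat_diff)
    from this[of x] this[of "x + s"] show ?thesis
      by (simp add: h_def add.commute add.left_commute power2_commute)
  qed
  have split: "(\<Sum>x<a + b. h x) = (\<Sum>x<a. h x) + (\<Sum>x<b. h (x + a))" for a b
    by (induction b) (auto simp: add.commute)
  have "(\<Sum>x<2*m. h x) = 2 * (\<Sum>x<m. h x)"
    using split[of m m] by (simp only: mult_2 half)
  also have "(\<Sum>x<m. h x) = (\<Sum>x<m - s. h x) + (\<Sum>u<s. h (u + (m - s)))"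
    using split[of "m - s" s] by (simp only: le_add_diff_inverse2[OF s])
  also have "(\<Sum>x<m - s. h x) = (\<Sum>x<m - s. (real s)\<^sup>2)"
    by (rule sum.cong) (auto simp: h_def zigzag_def)
  also have "(\<Sum>u<s. h (u + (m - s))) = (\<Sum>u<s. (2 * real u + 1 - real s)\<^sup>2)"
  proof (rule sum.cong)
    fix u assume "u \<in> {..<s}"
    then have "zigzag m (u + (m - s)) = u + (m - s)" "zigzag m (u + (m - s) + s) = m - 1 - u"
      using s by (auto simp: zigzag_def)
    then show "h (u + (m - s)) = (2 * real u + 1 - real s)\<^sup>2"
      using s \<open>u \<in> {..<s}\<close> unfolding h_def
      by (simp add: of_nat_diff algebra_simps)
  qed simp
  finally show ?thesis
    unfolding h_def sum_centered_squares using s by (simp add: of_nat_diff algebra_simps)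
qed (use s in auto)

lemma sum_even_odd: "(\<Sum>x<2*m. h x) = (\<Sum>i<m. h (2 * i) + h (2 * i + 1))" for h :: "nat \<Rightarrow> real"
  by (induction m) auto

text \<open>If a pair were discordant in all \<open>n\<close> consecutive steps, its order would be reversed an odd
  number of times on the way around the cycle.\<close>

lemma sum_card_concordant_ge:
  assumes "odd n" and bij: "\<And>j. j \<le> n \<Longrightarrow> bij_betw (q j) {..<m} {..<m}"
    and closed: "\<And>i. i < m \<Longrightarrow> q n i = q 0 i"
  shows "real m * (real m - 1) / 2 \<le> (\<Sum>j<n. real (card (concordant m (q j) (q (Suc j)))))"
proof -
  have ne: "q j i \<noteq> q j k" if "j \<le> n" "i < m" "k < m" "i \<noteq> k" for i j k
    using bij[OF that(1)] that by (auto simp: bij_betw_def inj_on_def)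
  define A where "A = {(i, k). i < m \<and> k < m \<and> i < k}"
  define S where "S = (SIGMA j:{..<n}. concordant m (q j) (q (Suc j)))"
  have fS: "finite S" by (simp add: S_def finite_concordant)
  \<comment> \<open>Forgetting the step and sorting the pair must reach every pair in
    \<open>A\<close>, which bounds the number of concordances from below.\<close>
  define srt where "srt = (\<lambda>(j :: nat, i :: nat, k :: nat). (min i k, max i k))"
  have "A \<subseteq> srt ` S"
  proof
    fix a assume "a \<in> A"
    then obtain i k where a: "a = (i, k)" and ik: "i < k" "i < m" "k < m"
      by (auto simp: A_def)
    have "\<exists>j<n. (q j i < q j k) = (q (Suc j) i < q (Suc j) k)"
    proof (rule ccontr)
      assume *: "\<not> ?thesis"
      have "j \<le> n \<Longrightarrow> (q j i < q j k) = ((q 0 i < q 0 k) = even j)" for j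
        by (induction j) (use * in auto)
      from this[of n] show False using \<open>odd n\<close> closed ik by auto
    qed
    then obtain j where j: "j < n" "(q j i < q j k) = (q (Suc j) i < q (Suc j) k)" by blast
    show "a \<in> srt ` S"
    proof (cases "q j i < q j k")
      case True
      then show ?thesis using j ik a
        by (intro image_eqI[of _ _ "(j, i, k)"]) (auto simp: S_def srt_def concordant_def)
    next
      case False
      then have "q j k < q j i" "q (Suc j) k < q (Suc j) i"
        using j ne[of j i k] ne[of "Suc j" i k] ik by auto
      then show ?thesis using j ik a
        by (intro image_eqI[of _ _ "(j, k, i)"]) (auto simp: S_def srt_def concordant_def)
    qed
  qed
  then have "card A \<le> card S"
    using fS by (meson card_image_le card_mono finite_imageI le_trans)
  moreover have "real (card A) = real m * (real m - 1) / 2"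
    unfolding A_def by (rule card_ordered_pairs) (simp add: bij_betw_def)
  moreover have "card S = (\<Sum>j<n. card (concordant m (q j) (q (Suc j))))"
    by (simp add: S_def finite_concordant)
  ultimately show ?thesis by (simp flip: of_nat_sum)
qed

text \<open>The sum of squares in \<open>card_swapped_edges\<close> for a shift by
  \<open>m + s\<close>, averaged over the two parities: half the value in
  \<open>sum_zigzag_step\<close>.\<close>

definition step_cost :: "nat \<Rightarrow> nat \<Rightarrow> real" where
  "step_cost m s = (real m - real s) * (real s)\<^sup>2 + (real s ^ 3 - real s) / 3"

text \<open>The assumption \<open>closed\<close> says that the shifts \<open>m + s j\<close> add up
  to a multiple of the period, so the last column agrees with the first. In the proof
  \<open>c j\<close> is the accumulated shift and \<open>b\<close> selects the parity.\<close>

theorem crossing_number_le_step_costs: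
  assumes n: "n \<ge> 3" and m: "m > 0" and s: "\<And>j. s j \<le> m"
    and closed: "2 * m dvd (\<Sum>j<n. s j) + n * m"
  shows "real (crossing_number (kronecker_product (complete_graph m) (cycle_graph n))) \<le>
    real n * real m * (real m - 1) * (real m - 2) * (3 * real m - 5) / 12
    + (\<Sum>j<n. step_cost m (s j)) - (if odd n then real m * (real m - 1) / 2 else 0)"
proof -
  define c where "c j = (\<Sum>l<j. s l) + j * m" for j
  define q where "q b j i = zigzag m (2 * i + (b + c j))" for b j i
  define D where "D b = (\<Sum>j<n. \<Sum>i<m. (real (q b j i) + real (q b (Suc j) i) - (real m - 1))\<^sup>2)" for b
  have bij: "bij_betw (q b j) {..<m} {..<m}" for b j
    unfolding q_def by (rule bij_betw_zigzag_double)
  obtain d where d: "c n = 2 * m * d" using closed by (auto simp: c_def)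
  have qn: "q b n i = q b 0 i" for b i
  proof -
    have "2 * i + (b + c n) = 2 * i + (b + c 0) + 2 * m * d"
      by (simp add: d) (simp add: c_def)
    then show ?thesis by (simp only: q_def zigzag_def mod_mult_self2)
  qed
  \<comment> \<open>The part \<open>m\<close> of the shift reverses positions and cancels
    \<open>m - 1\<close>, leaving the difference caused by \<open>s j\<close>.\<close>
  have step: "(real (q b j i) + real (q b (Suc j) i) - (real m - 1))\<^sup>2 =
      (real (zigzag m (2 * i + b + c j)) - real (zigzag m (2 * i + b + c j + s j)))\<^sup>2" for b j i
  proof -
    have "q b (Suc j) i = zigzag m (2 * i + b + c j + s j + m)"
      by (simp add: q_def c_def algebra_simps)
    then have "real (q b (Suc j) i) = real m - 1 - real (zigzag m (2 * i + b + c j + s j))"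
      using zigzag_add_half[OF m] zigzag_less[OF m, of "2 * i + b + c j + s j"] m
      by (simp add: of_nat_diff)
    then show ?thesis by (simp add: q_def add.assoc)
  qed
  have "D 0 + D 1 = (\<Sum>j<n. 2 * step_cost m (s j))"
    unfolding D_def sum.distrib[symmetric]
  proof (rule sum.cong)
    fix j
    define h where "h x = (real (zigzag m x) - real (zigzag m (x + s j)))\<^sup>2" for x
    have per: "h (x + 2 * m) = h x" for x
      using zigzag_periodic[of m x] zigzag_periodic[of m "x + s j"]
      by (simp add: h_def algebra_simps)
    have "(\<Sum>i<m. (real (q 0 j i) + real (q 0 (Suc j) i) - (real m - 1))\<^sup>2
        + (real (q 1 j i) + real (q 1 (Suc j) i) - (real m - 1))\<^sup>2)
      = (\<Sum>i<m. h (2 * i + c j) + h (2 * i + 1 + c j))"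
      unfolding step h_def by simp
    \<comment> \<open>The two parities together run over a full period, so the offset
      \<open>c j\<close> drops out.\<close>
    also have "\<dots> = (\<Sum>x<2*m. h (x + c j))"
      by (simp add: sum_even_odd)
    also have "\<dots> = (\<Sum>x<2*m. h x)"
      by (rule sum_periodic_shift[of h "2 * m", OF per])
    also have "\<dots> = 2 * step_cost m (s j)"
      unfolding h_def step_cost_def by (rule sum_zigzag_step[OF s])
    finally show "(\<Sum>i<m. (real (q 0 j i) + real (q 0 (Suc j) i) - (real m - 1))\<^sup>2
        + (real (q 1 j i) + real (q 1 (Suc j) i) - (real m - 1))\<^sup>2) = 2 * step_cost m (s j)" .
  qed simp
  then have "D 0 + D 1 = 2 * (\<Sum>j<n. step_cost m (s j))" by (simp add: sum_distrib_left)
  \<comment> \<open>One parity costs at most the average; it serves for all steps at once.\<close>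
  then have "D 0 \<le> (\<Sum>j<n. step_cost m (s j)) \<or> D 1 \<le> (\<Sum>j<n. step_cost m (s j))"
    by linarith
  then obtain b where b: "D b \<le> (\<Sum>j<n. step_cost m (s j))" by blast
  have "real (crossing_number (kronecker_product (complete_graph m) (cycle_graph n)))
      \<le> (\<Sum>j<n. real (card (swapped_edges m (q b j) (q b (Suc j)))))"
    unfolding of_nat_sum[symmetric] of_nat_le_iff
    using n bij qn by (intro crossing_number_le_swapped_edges) (auto simp: bij_betw_def)
  also have "\<dots> = real n * (real m * (real m - 1) * (real m - 2) * (3 * real m - 5) / 12) + D b
      - (\<Sum>j<n. real (card (concordant m (q b j) (q b (Suc j)))))"
    by (simp add: card_swapped_edges[OF bij bij] D_def sum.distrib sum_subtractf)
  also have "\<dots> \<le> real n * (real m * (real m - 1) * (real m - 2) * (3 * real m - 5) / 12)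
      + (\<Sum>j<n. step_cost m (s j)) - (if odd n then real m * (real m - 1) / 2 else 0)"
  proof -
    have "(if odd n then real m * (real m - 1) / 2 else 0)
        \<le> (\<Sum>j<n. real (card (concordant m (q b j) (q b (Suc j)))))"
      using sum_card_concordant_ge[of n "q b" m] bij qn by (auto intro: sum_nonneg)
    then show ?thesis using b by linarith
  qed
  finally show ?thesis by (simp add: mult.assoc)
qed

text \<open>Only \<open>K\<close> steps carry an extra shift; the others have
  \<open>s j = 0\<close>, which costs nothing.\<close>

corollary crossing_number_le_distributed:
  assumes "n \<ge> 3" "m > 0" "odd n" "K \<le> n"
    and s: "\<And>j. j < K \<Longrightarrow> s j \<le> m" and total: "(\<Sum>j<K. s j) = m"
  shows "real (crossing_number (kronecker_product (complete_graph m) (cycle_graph n))) \<le>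
    real n * real m * (real m - 1) * (real m - 2) * (3 * real m - 5) / 12
    + ((\<Sum>j<K. step_cost m (s j)) - real m * (real m - 1) / 2)"
proof -
  define s' where "s' j = (if j < K then s j else 0)" for j
  have K: "{..<n} \<inter> {j. j < K} = {..<K}" using \<open>K \<le> n\<close> by auto
  have "(\<Sum>j<n. s' j) = m"
    unfolding s'_def by (simp add: sum.If_cases K total)
  moreover have "(\<Sum>j<n. step_cost m (s' j)) = (\<Sum>j<n. if j < K then step_cost m (s j) else 0)"
    by (rule sum.cong) (auto simp: s'_def step_cost_def)
  moreover have "\<dots> = (\<Sum>j<K. step_cost m (s j))"
    by (simp add: sum.If_cases K)
  \<comment> \<open>The total shift is \<open>(n + 1) * m\<close>, and \<open>n + 1\<close> is
    even.\<close>
  moreover have "2 * m dvd m + n * m"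
    using \<open>odd n\<close> by (auto elim!: oddE simp: algebra_simps)
  moreover have "s' j \<le> m" for j using s by (simp add: s'_def)
  ultimately show ?thesis
    using crossing_number_le_step_costs[of n m s'] \<open>n \<ge> 3\<close> \<open>m > 0\<close> \<open>odd n\<close> by simp
qed

section \<open>Dividing the extra shift into nearly equal parts\<close>

lemma lessThan_3: "{..<3 :: nat} = {0, 1, 2}"
  by auto

text \<open>Passing from \<open>m\<close> to \<open>m + 1\<close> replaces the summand
  \<open>m div K\<close> by \<open>(m + K) div K\<close>, which is larger by 1.\<close>

lemma sum_div_shift:
  assumes "K > 0"
  shows "(\<Sum>j<K. (m + j) div K) = (m :: nat)"
proof (induction m)
  case (Suc m)
  have "(\<Sum>j<K. (Suc m + j) div K) + m div K = (\<Sum>j<K. (m + j) div K) + (m + K) div K"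
    using sum.lessThan_Suc_shift[of "\<lambda>j. (m + j) div K" K] by simp
  then show ?case using Suc assms by simp
qed simp

text \<open>With \<open>k = m div 3\<close>, the right side exceeds the left by
  \<open>2 * k / 3 + 4 / 27\<close>, \<open>8 / 27\<close> and \<open>0\<close> for \<open>m\<close>
  congruent to 0, 1 and 2 modulo 3; the last class accounts for the coefficients.\<close>

lemma step_costs_thirds:
  "(\<Sum>j<3. step_cost m ((m + j) div 3)) - real m * (real m - 1) / 2
    \<le> (28 * real m ^ 3 - 54 * real m ^ 2 + 42 * real m + 16) / 108"
proof -
  have eq: "(\<Sum>j<3. step_cost m ((m + j) div 3)) =
      step_cost m (m div 3) + step_cost m ((m + 1) div 3) + step_cost m ((m + 2) div 3)"
    unfolding lessThan_3 by simp
  define k where "k = m div 3"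
  consider "m = 3 * k" | "m = 3 * k + 1" | "m = 3 * k + 2"
    unfolding k_def by linarith
  then show ?thesis
  proof cases
    case 1
    then have "m div 3 = k" "(m + 1) div 3 = k" "(m + 2) div 3 = k" by auto
    then show ?thesis unfolding eq unfolding step_cost_def using 1
      by (simp only:) (simp add: field_simps power2_eq_square power3_eq_cube)
  next
    case 2
    then have "m div 3 = k" "(m + 1) div 3 = k" "(m + 2) div 3 = k + 1" by auto
    then show ?thesis unfolding eq unfolding step_cost_def using 2
      by (simp only:) (simp add: field_simps power2_eq_square power3_eq_cube)
  next
    case 3
    then have "m div 3 = k" "(m + 1) div 3 = k + 1" "(m + 2) div 3 = k + 1" by auto
    then show ?thesis unfolding eq unfolding step_cost_def using 3
      by (simp only:) (simp add: field_simps power2_eq_square power3_eq_cube)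
  qed
qed

text \<open>With a common bound \<open>x\<close> for all parts the estimate is linear in
  \<open>s\<close>, so summing it needs only the total of the parts.\<close>

lemma step_cost_le:
  assumes "real s \<le> x"
  shows "step_cost m s \<le> real s * (real m * x - 1)"
proof -
  have "real s \<le> real s ^ 3"
    by (cases "s = 0") (use self_le_power[of "real s" 3] in auto)
  moreover have "real m * (real s)\<^sup>2 \<le> real m * (real s * x)"
    unfolding power2_eq_square using assms by (intro mult_left_mono) auto
  moreover have "step_cost m s = real m * (real s)\<^sup>2 - 2 / 3 * real s ^ 3 - real s / 3"
    by (simp add: step_cost_def field_simps power2_eq_square power3_eq_cube)
  moreover have "real s * (real m * x - 1) = real m * (real s * x) - real s"
    by (simp add: algebra_simps)
  ultimately show ?thesis by linarith
qed

lemma step_costs_fifths: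
  assumes "m \<ge> 6"
  shows "(\<Sum>j<5. step_cost m ((m + j) div 5)) - real m * (real m - 1) / 2 \<le> real m ^ 3 / 4"
proof -
  have "(\<Sum>j<5. step_cost m ((m + j) div 5)) \<le>
      (\<Sum>j<5. real ((m + j) div 5) * (real m * (real (m + 4) / 5) - 1))"
  proof (intro sum_mono step_cost_le)
    fix j :: nat assume "j \<in> {..<5}"
    have "real ((m + j) div 5) \<le> real (m + j) / 5"
      using of_nat_div_le_of_nat[of "m + j" 5] by simp
    then show "real ((m + j) div 5) \<le> real (m + 4) / 5"
      using \<open>j \<in> {..<5}\<close> by simp
  qed
  also have "\<dots> = real m * (real m * (real (m + 4) / 5) - 1)"
    unfolding sum_distrib_right[symmetric] of_nat_sum[symmetric] by (simp add: sum_div_shift)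
  also have "\<dots> \<le> real m ^ 3 / 4 + real m * (real m - 1) / 2"
  proof -
    \<comment> \<open>The claim reduces to \<open>m^3 / 20 + m / 2\<close> being at least
      \<open>3 * m^2 / 10\<close>; \<open>m \<ge> 6\<close> suffices.\<close>
    have "6 * (real m)\<^sup>2 \<le> real m * (real m)\<^sup>2"
      using assms by (intro mult_right_mono) auto
    then show ?thesis by (simp add: field_simps power2_eq_square power3_eq_cube)
  qed
  finally show ?thesis by simp
qed

theorem theorem3p1:
  fixes m n :: nat
  assumes "n \<ge> 3" and "m \<ge> 4"
  shows "(n \<ge> 4 \<and> even n \<longrightarrow>
           real (crossing_number (kronecker_product (complete_graph m) (cycle_graph n)))
             \<le> real n * real m * (real m - 1) * (real m - 2) * (3 * real m - 5) / 12)
       \<and> (odd n \<and> 4 \<le> m \<and> m \<le> n \<longrightarrow>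
           real (crossing_number (kronecker_product (complete_graph m) (cycle_graph n)))
             \<le> real n * real m * (real m - 1) * (real m - 2) * (3 * real m - 5) / 12
               + real m * (real m - 1) / 2)
       \<and> (n = 3 \<and> m > 3 \<longrightarrow>
           real (crossing_number (kronecker_product (complete_graph m) (cycle_graph n)))
             \<le> real n * real m * (real m - 1) * (real m - 2) * (3 * real m - 5) / 12
               + (28 * real m ^ 3 - 54 * real m ^ 2 + 42 * real m + 16) / 108)
       \<and> (n \<ge> 5 \<and> odd n \<and> m > n \<longrightarrow>
           real (crossing_number (kronecker_product (complete_graph m) (cycle_graph n)))
             \<le> real n * real m * (real m - 1) * (real m - 2) * (3 * real m - 5) / 12
               + real m ^ 3 / 4)"
proof (intro conjI impI; elim conjE)
  assume "even n"
  \<comment> \<open>All extra shifts are 0: an even number of reversals closes up by itself.\<close>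
  then have "real (crossing_number (kronecker_product (complete_graph m) (cycle_graph n)))
      \<le> real n * real m * (real m - 1) * (real m - 2) * (3 * real m - 5) / 12
        + (\<Sum>j<n. step_cost m 0) - (if odd n then real m * (real m - 1) / 2 else 0)"
    using assms by (intro crossing_number_le_step_costs) auto
  then show "real (crossing_number (kronecker_product (complete_graph m) (cycle_graph n)))
      \<le> real n * real m * (real m - 1) * (real m - 2) * (3 * real m - 5) / 12"
    using \<open>even n\<close> by (simp only: step_cost_def) simp
next
  assume "odd n" "m \<le> n"
  \<comment> \<open>Each unit shift costs \<open>m - 1\<close>, and \<open>m \<le> n\<close> leaves
    room for \<open>m\<close> of them; the concordant pairs save half of the total.\<close>
  have "(\<Sum>j<m. step_cost m 1) - real m * (real m - 1) / 2 = real m * (real m - 1) / 2"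
    by (simp add: step_cost_def field_simps)
  moreover have "real (crossing_number (kronecker_product (complete_graph m) (cycle_graph n)))
      \<le> real n * real m * (real m - 1) * (real m - 2) * (3 * real m - 5) / 12
        + ((\<Sum>j<m. step_cost m 1) - real m * (real m - 1) / 2)"
    using \<open>odd n\<close> \<open>m \<le> n\<close> assms by (intro crossing_number_le_distributed) auto
  ultimately show "real (crossing_number (kronecker_product (complete_graph m) (cycle_graph n)))
      \<le> real n * real m * (real m - 1) * (real m - 2) * (3 * real m - 5) / 12
        + real m * (real m - 1) / 2"
    by linarith
next
  assume "n = 3"
  have "real (crossing_number (kronecker_product (complete_graph m) (cycle_graph n)))
      \<le> real n * real m * (real m - 1) * (real m - 2) * (3 * real m - 5) / 12
        + ((\<Sum>j<3. step_cost m ((m + j) div 3)) - real m * (real m - 1) / 2)"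
    using \<open>n = 3\<close> assms by (intro crossing_number_le_distributed sum_div_shift) auto
  then show "real (crossing_number (kronecker_product (complete_graph m) (cycle_graph n)))
      \<le> real n * real m * (real m - 1) * (real m - 2) * (3 * real m - 5) / 12
        + (28 * real m ^ 3 - 54 * real m ^ 2 + 42 * real m + 16) / 108"
    using step_costs_thirds[of m] by linarith
next
  assume "n \<ge> 5" "odd n" "m > n"
  then have "real (crossing_number (kronecker_product (complete_graph m) (cycle_graph n)))
      \<le> real n * real m * (real m - 1) * (real m - 2) * (3 * real m - 5) / 12
        + ((\<Sum>j<5. step_cost m ((m + j) div 5)) - real m * (real m - 1) / 2)"
    using assms by (intro crossing_number_le_distributed sum_div_shift) auto
  then show "real (crossing_number (kronecker_product (complete_graph m) (cycle_graph n)))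
      \<le> real n * real m * (real m - 1) * (real m - 2) * (3 * real m - 5) / 12 + real m ^ 3 / 4"
    using step_costs_fifths[of m] \<open>n \<ge> 5\<close> \<open>m > n\<close> by simp
qed

end
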